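(* Let $h:\mathbb{R}^d\to\mathbb{R}^p$ be differentiable at $\mu_t\in\mathbb{R}^d$ with Jacobian matrix $H_t\in\mathbb{R}^{p\times d}$ at $\mu_t$, let $\Sigma_t\in\mathbb{R}^{d\times d}$ and $R_t\in\mathbb{R}^{p\times p}$ be symmetric positive definite, and let $y_t\in\mathbb{R}^p$. The extended Kalman filter (EKF) corresponds to optimizing, over Gaussian $q$, the variational objective $$\mathcal{L}(q)=-\tfrac12\mathbb{E}_q\big[(y_t-h(x_t))^\top R_t^{-1}(y_t-h(x_t))\big]+\mathbb{E}_q[\ln p(x_t|y_{1:t-1})]-\mathbb{E}_q[\ln q(x_t)],\qquad p(x_t|y_{1:t-1})=N(\mu_t,\Sigma_t),$$ (stated up to an additive constant independent of $q$) with $h$ replaced by its first-order Taylor approximation at the prior mean $\mu_t$. That is, if $\widetilde{\mathcal{L}}(q)$ denotes the objective obtained from $\mathcal{L}(q)$ by replacing $h(x)$ with $h(\mu_t)+H_t(x-\mu_t)$, then among all Gaussian distributions $q=N(\hat\mu_t,\hat\Sigma_t)$ on $\mathbb{R}^d$ with $\hat\Sigma_t$ symmetric positive definite, $\widetilde{\mathcal{L}}$ is maximized by the EKF update $$\hat\mu_t=\mu_t+K_t\,(y_t-h(\mu_t)),\qquad \hat\Sigma_t=\Sigma_t-K_tS_tK_t^\top,$$ where $S_t=H_t\Sigma_tH_t^\top+R_t$ and $K_t=\Sigma_tH_t^\top S_t^{-1}$.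
   Context: Nonlinear Kalman filtering model: $x_t=F_tx_{t-1}+w_t$, $y_t=h(x_t)+v_t$, with $x_t\in\mathbb{R}^d$ the hidden state, $y_t\in\mathbb{R}^p$ the measurement, and $w_t,v_t$ independent zero-mean Gaussian vectors, $v_t$ having covariance $R_t$. At time $t$ the prior is the Gaussian $p(x_t|y_{1:t-1})=N(\mu_t,\Sigma_t)$. The objective $\mathcal{L}(q)$ is (up to an additive constant) the variational lower bound on the log marginal likelihood of $y_t$ given $y_{1:t-1}$; maximizing it over $q$ is equivalent to minimizing $\mathrm{KL}[q\|p(x_t|y_{1:t})]$. The extended Kalman filter (EKF) is the filter whose approximate posterior at time $t$ is $N(\hat\mu_t,\hat\Sigma_t)$ with $\hat\mu_t=\mu_t+K_t(y_t-h(\mu_t))$, $\hat\Sigma_t=\Sigma_t-K_tS_tK_t^\top$, $S_t=H_t\Sigma_tH_t^\top+R_t$, $K_t=\Sigma_tH_t^\top S_t^{-1}$, where $H_t$ is the Jacobian of $h$ at the prior mean $\mu_t$. *)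

theory Defs
  imports "HOL-Probability.Probability"
begin

definition sym_pos_def :: "real ^ 'n ^ 'n \<Rightarrow> bool" where
  "sym_pos_def A \<longleftrightarrow> transpose A = A \<and> (\<forall>x. x \<noteq> 0 \<longrightarrow> 0 < x \<bullet> (A *v x))"

(* Lebesgue density of N(m, P); the covariance P is meant to satisfy sym_pos_def. *)
definition gaussian_density ::
    "real ^ 'n \<Rightarrow> real ^ 'n ^ 'n \<Rightarrow> real ^ 'n \<Rightarrow> real" where
  "gaussian_density m P x =
     exp (- (1/2) * ((x - m) \<bullet> (matrix_inv P *v (x - m)))) / sqrt ((2 * pi) ^ CARD('n) * det P)"

(* E_q[f] for the distribution with Lebesgue density q. *)
definition expect :: "(real ^ 'n \<Rightarrow> real) \<Rightarrow> (real ^ 'n \<Rightarrow> real) \<Rightarrow> real" where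
  "expect q f = (\<integral>x. f x \<partial>density lborel (\<lambda>x. ennreal (q x)))"

(* Observation function h, observation noise covariance R, observation y, prior density p;
   the distribution q is given by its density. *)
definition variational_objective ::
    "(real ^ 'd \<Rightarrow> real ^ 'p) \<Rightarrow> real ^ 'p ^ 'p \<Rightarrow> real ^ 'p \<Rightarrow> (real ^ 'd \<Rightarrow> real) \<Rightarrow>
     (real ^ 'd \<Rightarrow> real) \<Rightarrow> real" where
  "variational_objective h R y p q =
     - (1/2) * expect q (\<lambda>x. (y - h x) \<bullet> (matrix_inv R *v (y - h x)))
     + expect q (\<lambda>x. ln (p x))
     - expect q (\<lambda>x. ln (q x))"

definition taylor1 :: "(real ^ 'd \<Rightarrow> real ^ 'p) \<Rightarrow> real ^ 'd \<Rightarrow> real ^ 'd \<Rightarrow> real ^ 'p" where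
  "taylor1 h \<mu> x = h \<mu> + jacobian h (at \<mu>) *v (x - \<mu>)"

definition ekf_S ::
    "(real ^ 'd \<Rightarrow> real ^ 'p) \<Rightarrow> real ^ 'd \<Rightarrow> real ^ 'd ^ 'd \<Rightarrow> real ^ 'p ^ 'p \<Rightarrow> real ^ 'p ^ 'p" where
  "ekf_S h \<mu> \<Sigma> R = jacobian h (at \<mu>) ** \<Sigma> ** transpose (jacobian h (at \<mu>)) + R"

definition ekf_K ::
    "(real ^ 'd \<Rightarrow> real ^ 'p) \<Rightarrow> real ^ 'd \<Rightarrow> real ^ 'd ^ 'd \<Rightarrow> real ^ 'p ^ 'p \<Rightarrow> real ^ 'p ^ 'd" where
  "ekf_K h \<mu> \<Sigma> R = \<Sigma> ** transpose (jacobian h (at \<mu>)) ** matrix_inv (ekf_S h \<mu> \<Sigma> R)"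

definition ekf_mean ::
    "(real ^ 'd \<Rightarrow> real ^ 'p) \<Rightarrow> real ^ 'd \<Rightarrow> real ^ 'd ^ 'd \<Rightarrow> real ^ 'p ^ 'p \<Rightarrow> real ^ 'p \<Rightarrow>
     real ^ 'd" where
  "ekf_mean h \<mu> \<Sigma> R y = \<mu> + ekf_K h \<mu> \<Sigma> R *v (y - h \<mu>)"

definition ekf_cov ::
    "(real ^ 'd \<Rightarrow> real ^ 'p) \<Rightarrow> real ^ 'd \<Rightarrow> real ^ 'd ^ 'd \<Rightarrow> real ^ 'p ^ 'p \<Rightarrow> real ^ 'd ^ 'd" where
  "ekf_cov h \<mu> \<Sigma> R =
     \<Sigma> - ekf_K h \<mu> \<Sigma> R ** ekf_S h \<mu> \<Sigma> R ** transpose (ekf_K h \<mu> \<Sigma> R)"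

end

theory Submission imports Defs begin

text \<open>
  Why the update is optimal. With \<open>h\<close> replaced by an affine map, the integrand
  \<open>- 1/2 (y - h x) \<bullet> R\<^sup>-\<^sup>1 (y - h x) + ln p(x)\<close> of the objective is a concave quadratic
  polynomial in \<open>x\<close>. Completing the square (\<open>complete_square\<close>) shows that it equals \<open>c + ln r(x)\<close>, where
  \<open>c\<close> is a constant and \<open>r\<close> is the Gaussian density whose precision matrix is
  \<open>\<Sigma>\<^sup>-\<^sup>1 + H\<^sup>T R\<^sup>-\<^sup>1 H\<close> and whose mean is the prior mean shifted by \<open>K (y - h \<mu>)\<close>.
  The covariance form of the Kalman update agrees with this information form
  (\<open>kalman_information_form\<close>), so \<open>r\<close> is exactly the density of the EKF update. Hence
  the linearized objective of a Gaussian \<open>q\<close> is \<open>c + E_q[ln r] - E_q[ln q] = c - KL(q | r)\<close>. By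
  Gibbs' inequality (\<open>gibbs_inequality_gaussian\<close>) it is at most \<open>c\<close>, and it equals \<open>c\<close> for
  \<open>q = r\<close>. Traces, determinants and moments of \<open>q\<close> never have to be computed.

  This argument needs two analytic facts about the explicit density formula: it integrates to
  one (\<open>nn_integral_gaussian_density\<close>), and quadratic polynomials are integrable against it
  (\<open>integrable_gaussian_quadratic\<close>), since otherwise the three expectations of the objective could
  not be added. The first follows by substituting \<open>x = m + C u\<close>, where \<open>C\<close> turns the
  quadratic form of the inverse covariance into \<open>u \<bullet> u\<close> (\<open>gaussian_whitening\<close>), which leaves a
  product of one-dimensional standard normal densities. The second follows from the first by
  comparison with a Gaussian of doubled covariance.
\<close>

section \<open>Linear substitution in Lebesgue integrals\<close>

lemma borel_measurable_matrix_vector_mult [measurable (raw)]: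
  fixes A :: "real^'n^'m"
  assumes "f \<in> borel_measurable M"
  shows "(\<lambda>x. A *v f x) \<in> borel_measurable M"
  by (rule borel_measurable_continuous_on[OF _ assms]) (intro continuous_intros)

text \<open>
  Integrate over the coordinate along \<open>b\<close> first (Fubini). As \<open>w\<close> is orthogonal to \<open>b\<close>, the
  displacement \<open>w \<bullet> x\<close> is constant along that coordinate, so the shear acts on the inner integral as
  a translation.
\<close>
lemma nn_integral_lborel_shear:
  fixes f :: "'a::euclidean_space \<Rightarrow> ennreal"
  assumes f [measurable]: "f \<in> borel_measurable borel"
    and b: "b \<in> Basis" and w: "w \<bullet> b = 0"
  shows "(\<integral>\<^sup>+x. f (x + (w \<bullet> x) *\<^sub>R b) \<partial>lborel) = (\<integral>\<^sup>+x. f x \<partial>lborel)"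
proof -
  interpret product_sigma_finite "\<lambda>_::'a. lborel :: real measure"
    by standard
  let ?B = "Basis - {b}"
  let ?s = "\<lambda>g::'a \<Rightarrow> real. \<Sum>c\<in>Basis. g c *\<^sub>R c"
  have B: "Basis = insert b ?B"
    using b by auto
  have s_upd: "?s (g(b := y)) = (\<Sum>c\<in>?B. g c *\<^sub>R c) + y *\<^sub>R b" for g y
    by (subst B, subst sum.insert) (auto intro!: sum.cong)
  have fubini: "(\<integral>\<^sup>+x. F x \<partial>lborel) =
      (\<integral>\<^sup>+g. (\<integral>\<^sup>+y. F ((\<Sum>c\<in>?B. g c *\<^sub>R c) + y *\<^sub>R b) \<partial>lborel) \<partial>Pi\<^sub>M ?B (\<lambda>_. lborel))"
    if [measurable]: "F \<in> borel_measurable borel" for F :: "'a \<Rightarrow> ennreal"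
  proof -
    have "(\<integral>\<^sup>+x. F x \<partial>lborel) = (\<integral>\<^sup>+g. F (?s g) \<partial>Pi\<^sub>M Basis (\<lambda>_. lborel))"
      by (subst lborel_eq) (simp add: nn_integral_distr)
    also have "\<dots> = (\<integral>\<^sup>+g. F (?s g) \<partial>Pi\<^sub>M (insert b ?B) (\<lambda>_. lborel))"
      using B by simp
    also have "\<dots> = (\<integral>\<^sup>+g. (\<integral>\<^sup>+y. F (?s (g(b := y))) \<partial>lborel) \<partial>Pi\<^sub>M ?B (\<lambda>_. lborel))"
      by (rule product_nn_integral_insert) (auto simp flip: B)
    finally show ?thesis
      by (simp only: s_upd)
  qed
  have translate: "(\<integral>\<^sup>+y. F (y + t) \<partial>lborel) = (\<integral>\<^sup>+y. F y \<partial>lborel)"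
    if [measurable]: "F \<in> borel_measurable borel" for F :: "real \<Rightarrow> ennreal" and t
    by (subst (2) lborel_distr_plus[of t, symmetric])
      (simp add: nn_integral_distr add.commute)
  have "(\<integral>\<^sup>+y. f (v + y *\<^sub>R b + (w \<bullet> (v + y *\<^sub>R b)) *\<^sub>R b) \<partial>lborel) = (\<integral>\<^sup>+y. f (v + y *\<^sub>R b) \<partial>lborel)" for v
    using translate[of "\<lambda>y. f (v + y *\<^sub>R b)" "w \<bullet> v"] w
    by (simp add: inner_add_right algebra_simps)
  then show ?thesis
    by (simp add: fubini)
qed

text \<open>
  Lebesgue measure is determined by its values on boxes, and permuting two coordinates maps boxes
  to boxes with the same side lengths.
\<close>
lemma nn_integral_lborel_swap:
  fixes f :: "real^'n \<Rightarrow> ennreal"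
  assumes [measurable]: "f \<in> borel_measurable borel"
  shows "(\<integral>\<^sup>+x. f (\<chi> i. x $ Transposition.transpose m n i) \<partial>lborel) = (\<integral>\<^sup>+x. f x \<partial>lborel)"
proof -
  let ?T = "\<lambda>x::real^'n. \<chi> i. x $ Transposition.transpose m n i"
  have [measurable]: "?T \<in> borel \<rightarrow>\<^sub>M borel"
    by (intro borel_measurable_continuous_onI continuous_intros)
  have "lborel = distr lborel borel ?T"
  proof (rule lborel_eqI)
    fix l u :: "real^'n"
    assume le: "\<And>b. b \<in> Basis \<Longrightarrow> l \<bullet> b \<le> u \<bullet> b"
    have le': "l $ i \<le> u $ i" for i
      using le[of "axis i 1"] by (simp add: inner_axis axis_in_Basis_iff)
    have "?T -` box l u = box (?T l) (?T u)"
      by (auto simp: mem_box_cart) (metis transpose_involutory)+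
    moreover have "(\<Prod>i\<in>UNIV. (u - l) $ Transposition.transpose m n i) = (\<Prod>i\<in>UNIV. (u - l) $ i)"
      by (rule prod.reindex_bij_betw) simp
    moreover have "(\<Prod>b\<in>Basis. v \<bullet> b) = (\<Prod>i\<in>UNIV. v $ i)" for v :: "real^'n"
      by (simp add: Basis_vec_def UNION_singleton_eq_range prod.reindex inj_on_def axis_eq_axis inner_axis)
    ultimately show "emeasure (distr lborel borel ?T) (box l u) = (\<Prod>b\<in>Basis. (u - l) \<bullet> b)"
      using le'
      by (auto simp: emeasure_distr emeasure_lborel_box_eq Basis_vec_def inner_axis)
  qed simp
  then have "(\<integral>\<^sup>+x. f x \<partial>lborel) = (\<integral>\<^sup>+x. f x \<partial>distr lborel borel ?T)"
    by simp
  then show ?thesis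
    by (simp add: nn_integral_distr)
qed

lemma nn_integral_lborel_diagonal:
  fixes f :: "real^'n \<Rightarrow> ennreal" and A :: "real^'n^'n"
  assumes [measurable]: "f \<in> borel_measurable borel"
    and diag: "\<And>i j. i \<noteq> j \<Longrightarrow> A $ i $ j = 0" and det: "det A \<noteq> 0"
  shows "(\<integral>\<^sup>+x. f x \<partial>lborel) = ennreal \<bar>det A\<bar> * (\<integral>\<^sup>+x. f (A *v x) \<partial>lborel)"
proof -
  \<comment> \<open>the diagonal entries of the matrix, indexed by basis vectors instead of coordinates\<close>
  define c where "c b = b \<bullet> (A *v b)" for b
  have det_eq: "det A = (\<Prod>i\<in>UNIV. A $ i $ i)"
    by (rule det_diagonal) (use diag in auto)
  have c_axis: "c (axis i 1) = A $ i $ i" for i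
    by (simp add: c_def matrix_vector_mult_basis inner_axis' column_def)
  have T: "0 + (\<Sum>j\<in>Basis. (c j * (x \<bullet> j)) *\<^sub>R j) = A *v x" for x
  proof -
    have "(A *v x) $ i = A $ i $ i * x $ i" for i
      by (simp add: matrix_vector_mult_def sum.remove[of UNIV i] diag)
    then have "(\<Sum>j\<in>Basis. (c j * (x \<bullet> j)) *\<^sub>R j) \<bullet> axis i 1 = (A *v x) \<bullet> axis i 1" for i
      by (subst inner_sum_left_Basis) (auto simp: c_axis inner_axis axis_in_Basis_iff)
    then show ?thesis
      by (simp add: vec_eq_iff inner_axis)
  qed
  have "c b \<noteq> 0" if "b \<in> Basis" for b
    using that det det_eq by (auto simp: Basis_vec_def c_axis)
  then have "lborel = density (distr lborel borel (\<lambda>x. A *v x)) (\<lambda>_. \<Prod>j\<in>Basis. \<bar>c j\<bar>)"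
    using lborel_affine_euclidean[of c 0] unfolding T by simp
  moreover have "(\<Prod>j\<in>Basis. \<bar>c j\<bar>) = \<bar>det A\<bar>"
    by (simp add: Basis_vec_def UNION_singleton_eq_range prod.reindex inj_on_def axis_eq_axis
        c_axis det_eq abs_prod)
  ultimately have "lborel = density (distr lborel borel (\<lambda>x. A *v x)) (\<lambda>_. \<bar>det A\<bar>)"
    by simp
  then have "(\<integral>\<^sup>+x. f x \<partial>lborel) =
      (\<integral>\<^sup>+x. f x \<partial>density (distr lborel borel (\<lambda>x. A *v x)) (\<lambda>_. \<bar>det A\<bar>))"
    by simp
  then show ?thesis
    by (simp add: nn_integral_density nn_integral_distr nn_integral_cmult)
qed

text \<open>
  Both sides are multiplicative in \<open>A\<close>, so it suffices to check the elementary matrices. A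
  matrix with a zero row is excluded by the determinant; diagonal matrices, transpositions and
  shears are the three substitutions above.
\<close>
lemma nn_integral_lborel_linear_substitution:
  fixes f :: "real^'n \<Rightarrow> ennreal" and A :: "real^'n^'n"
  assumes "f \<in> borel_measurable borel" and "det A \<noteq> 0"
  shows "(\<integral>\<^sup>+x. f x \<partial>lborel) = ennreal \<bar>det A\<bar> * (\<integral>\<^sup>+x. f (A *v x) \<partial>lborel)"
proof -
  let ?P = "\<lambda>A::real^'n^'n. det A \<noteq> 0 \<longrightarrow> (\<forall>f\<in>borel_measurable borel.
      (\<integral>\<^sup>+x. f x \<partial>lborel) = ennreal \<bar>det A\<bar> * (\<integral>\<^sup>+x. f (A *v x) \<partial>lborel))"
  have "?P A"
  proof (rule induct_matrix_elementary_alt[of ?P])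
    fix A B :: "real^'n^'n"
    assume A: "?P A" and B: "?P B"
    show "?P (A ** B)"
    proof (intro impI ballI)
      fix f :: "real^'n \<Rightarrow> ennreal"
      assume det: "det (A ** B) \<noteq> 0" and f [measurable]: "f \<in> borel_measurable borel"
      have dets: "det A \<noteq> 0" "det B \<noteq> 0"
        using det by (auto simp: det_mul)
      have "(\<integral>\<^sup>+x. f x \<partial>lborel) = ennreal \<bar>det A\<bar> * (\<integral>\<^sup>+x. f (A *v x) \<partial>lborel)"
        by (rule A[rule_format, OF dets(1) f])
      also have "(\<integral>\<^sup>+x. f (A *v x) \<partial>lborel) =
          ennreal \<bar>det B\<bar> * (\<integral>\<^sup>+x. f (A *v (B *v x)) \<partial>lborel)"
        by (rule B[rule_format, OF dets(2)]) measurable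
      finally show "(\<integral>\<^sup>+x. f x \<partial>lborel) =
          ennreal \<bar>det (A ** B)\<bar> * (\<integral>\<^sup>+x. f ((A ** B) *v x) \<partial>lborel)"
        by (simp add: matrix_vector_mul_assoc det_mul abs_mult ennreal_mult mult.assoc)
    qed
  next
    fix A :: "real^'n^'n" and i
    assume "row i A = 0"
    then show "?P A"
      by (metis det_zero_row(2))
  next
    fix A :: "real^'n^'n"
    assume "\<And>i j. i \<noteq> j \<Longrightarrow> A $ i $ j = 0"
    then show "?P A"
      using nn_integral_lborel_diagonal by blast
  next
    fix m n :: 'n
    assume mn: "m \<noteq> n"
    let ?A = "\<chi> i j. mat 1 $ i $ Transposition.transpose m n j :: real^'n^'n"
    have "?A = (\<chi> i. mat 1 $ Transposition.transpose m n i)"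
      by (auto simp: vec_eq_iff mat_def transpose_eq_iff)
    then have det: "\<bar>det ?A\<bar> = 1"
      using mn by (simp add: det_permute_rows permutes_swap_id sign_swap_id)
    have "?A *v x = (\<chi> i. x $ Transposition.transpose m n i)" for x :: "real^'n"
    proof -
      have "(\<Sum>j\<in>UNIV. (if i = Transposition.transpose m n j then 1 else 0) * x $ j) =
          x $ Transposition.transpose m n i" for i
        by (subst sum.remove[of _ "Transposition.transpose m n i"])
          (auto intro!: sum.neutral split: if_splits)
      then show ?thesis
        by (simp add: matrix_vector_mult_def mat_def)
    qed
    then show "?P ?A"
      using det by (auto intro!: nn_integral_lborel_swap[symmetric])
  next
    fix m n :: 'n
    assume mn: "m \<noteq> n"
    let ?A = "\<chi> i j. of_bool (i = m \<and> j = n \<or> i = j) :: real^'n^'n"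
    have "?A = (\<chi> k. if k = m then row m (mat 1) + 1 *s row n (mat 1) else row k (mat 1))"
      using mn by (auto simp: vec_eq_iff row_def mat_def)
    then have det: "det ?A = 1"
      by (simp only: det_row_operation[OF mn] det_I)
    have "?A *v x = x + (axis n 1 \<bullet> x) *\<^sub>R axis m 1" for x :: "real^'n"
    proof -
      have "(\<Sum>j\<in>UNIV. of_bool (i = m \<and> j = n \<or> i = j) * x $ j) = x $ i + (if i = m then x $ n else 0)" for i
        using mn by (auto simp: of_bool_def if_distrib[of "\<lambda>z. z * y" for y] sum.remove cong: if_cong)
      then show ?thesis
        unfolding inner_axis' by (simp add: matrix_vector_mult_def vec_eq_iff axis_def)
    qed
    moreover have "axis m (1::real) \<in> Basis" "axis n 1 \<bullet> axis m (1::real) = 0"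
      using mn by (simp_all add: axis_in_Basis_iff inner_axis_axis)
    ultimately show "?P ?A"
      using det by (auto intro!: nn_integral_lborel_shear[symmetric])
  qed
  then show ?thesis
    using assms by blast
qed

section \<open>Symmetric positive definite matrices\<close>
lemma matrix_inv_eqI:
  fixes A B :: "real^'n^'n"
  assumes "A ** B = mat 1"
  shows "matrix_inv A = B"
proof -
  have "A ** matrix_inv A = mat 1 \<and> matrix_inv A ** A = mat 1"
    unfolding matrix_inv_def
    by (rule someI[of _ B]) (use assms matrix_left_right_inverse in auto)
  then show ?thesis
    by (metis assms matrix_mul_assoc matrix_mul_lid matrix_mul_rid)
qed

lemma inner_matrix_transpose:
  fixes A :: "real^'n^'m"
  shows "x \<bullet> (A *v y) = (transpose A *v x) \<bullet> y"
  by (simp add: dot_lmul_matrix)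

lemma inner_congruence:
  fixes G :: "real^'n^'m"
  shows "(G *v x) \<bullet> (B *v (G *v y)) = x \<bullet> ((transpose G ** B ** G) *v y)"
  by (simp only: matrix_vector_mul_assoc[symmetric] inner_matrix_transpose[of x "transpose G"]
      transpose_transpose)

lemma sym_pos_def_inner_commute:
  assumes "sym_pos_def A"
  shows "x \<bullet> (A *v y) = y \<bullet> (A *v x)"
  using assms by (metis inner_commute inner_matrix_transpose sym_pos_def_def)

lemma sym_pos_def_nonneg: "sym_pos_def A \<Longrightarrow> 0 \<le> x \<bullet> (A *v x)"
  by (cases "x = 0") (auto simp: sym_pos_def_def intro: less_imp_le)

text \<open>
  Positive definiteness makes the kernel trivial, so a left inverse exists. For positivity of
  the inverse \<open>B\<close>, write \<open>x = A (B x)\<close>, so that \<open>x \<bullet> B x\<close> becomes the form of \<open>A\<close> at \<open>B x\<close>.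
\<close>
lemma sym_pos_def_inverse:
  fixes A :: "real^'n^'n"
  assumes A: "sym_pos_def A"
  shows "A ** matrix_inv A = mat 1" "matrix_inv A ** A = mat 1" "sym_pos_def (matrix_inv A)"
proof -
  have "x = 0" if "A *v x = 0" for x
    using that A by (metis inner_zero_right less_irrefl sym_pos_def_def)
  then obtain B where B: "B ** A = mat 1"
    using matrix_left_invertible_ker[of A] by blast
  then have AB: "A ** B = mat 1"
    by (simp add: matrix_left_right_inverse)
  have inv: "matrix_inv A = B"
    by (rule matrix_inv_eqI[OF AB])
  show "A ** matrix_inv A = mat 1" "matrix_inv A ** A = mat 1"
    using AB B inv by simp_all
  have "transpose B ** A = mat 1"
    using A AB by (metis matrix_transpose_mul sym_pos_def_def transpose_mat)
  then have "transpose B = B"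
    by (metis AB matrix_mul_assoc matrix_mul_lid matrix_mul_rid)
  moreover have "0 < x \<bullet> (B *v x)" if "x \<noteq> 0" for x
  proof -
    have ABx: "A *v (B *v x) = x"
      by (simp add: matrix_vector_mul_assoc AB)
    then have "B *v x \<noteq> 0"
      using that by auto
    then have "0 < (B *v x) \<bullet> (A *v (B *v x))"
      using A by (auto simp: sym_pos_def_def)
    then show ?thesis
      by (simp only: ABx inner_commute)
  qed
  ultimately show "sym_pos_def (matrix_inv A)"
    by (simp add: sym_pos_def_def inv)
qed

lemma sym_pos_def_add_congruence:
  fixes A :: "real^'n^'n" and B :: "real^'m^'m" and G :: "real^'m^'n"
  assumes A: "sym_pos_def A" and B: "sym_pos_def B"
  shows "sym_pos_def (A + G ** B ** transpose G)"
proof -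
  have tr: "transpose (A + C) = transpose A + transpose C" for C :: "real^'n^'n"
    by (simp add: transpose_def vec_eq_iff)
  have "x \<bullet> ((G ** B ** transpose G) *v x) = (transpose G *v x) \<bullet> (B *v (transpose G *v x))" for x
    by (simp only: inner_congruence transpose_transpose)
  then have "0 < x \<bullet> ((A + G ** B ** transpose G) *v x)" if "x \<noteq> 0" for x
    using that A sym_pos_def_nonneg[OF B, of "transpose G *v x"]
    by (simp add: matrix_vector_mult_add_rdistrib inner_add_right sym_pos_def_def add_pos_nonneg)
  then show ?thesis
    using A B by (simp add: sym_pos_def_def tr matrix_transpose_mul matrix_mul_assoc)
qed

text \<open>
  Gram-Schmidt for the inner product \<open>x \<bullet> A y\<close>. The orthonormal family is indexed by the
  index type of the vectors itself, and built up over subsets of it, so that it can be used as the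
  columns of a square matrix.
\<close>
lemma sym_pos_def_congruent_identity:
  fixes A :: "real^'n^'n"
  assumes A: "sym_pos_def A"
  obtains C :: "real^'n^'n" where "transpose C ** A ** C = mat 1"
proof -
  have "\<exists>b :: 'n \<Rightarrow> real^'n. \<forall>i\<in>S. \<forall>j\<in>S. b i \<bullet> (A *v b j) = (if i = j then 1 else 0)" for S :: "'n set"
    using finite[of S]
  proof (induction S rule: finite_induct)
    case empty
    then show ?case by simp
  next
    case (insert k S)
    then obtain b :: "'n \<Rightarrow> real^'n" where
      b: "\<And>i j. i \<in> S \<Longrightarrow> j \<in> S \<Longrightarrow> b i \<bullet> (A *v b j) = (if i = j then 1 else 0)"
      by blast
    have "dim (span (b ` S)) \<le> card (b ` S)"
      by (simp add: dim_le_card')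
    also have "\<dots> \<le> card S"
      by (rule card_image_le) simp
    also have "\<dots> < CARD('n)"
      using insert.hyps by (intro psubset_card_mono) auto
    finally have "span (b ` S) \<noteq> UNIV"
      by (metis dim_UNIV DIM_cart DIM_real less_irrefl mult.right_neutral)
    then obtain x where x: "x \<notin> span (b ` S)"
      by auto
    \<comment> \<open>the component of a vector outside the span that is orthogonal to the family so far\<close>
    define w where "w = x - (\<Sum>j\<in>S. (x \<bullet> (A *v b j)) *\<^sub>R b j)"
    have "(\<Sum>j\<in>S. (x \<bullet> (A *v b j)) *\<^sub>R b j) \<in> span (b ` S)"
      by (intro span_sum span_scale span_base imageI)
    then have "w \<noteq> 0"
      using x by (auto simp: w_def)
    then have pos: "0 < w \<bullet> (A *v w)"
      using A by (simp add: sym_pos_def_def)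
    have orth: "w \<bullet> (A *v b i) = 0" if "i \<in> S" for i
      using that
      by (simp add: w_def inner_diff_left inner_sum_left b sum.delta if_distrib cong: if_cong)
    have orth': "b i \<bullet> (A *v w) = 0" if "i \<in> S" for i
      using orth[OF that] sym_pos_def_inner_commute[OF A] by metis
    define s where "s = sqrt (w \<bullet> (A *v w))"
    have s: "s \<noteq> 0" "w \<bullet> (A *v w) = s * s"
      using pos by (simp_all add: s_def)
    define b' where "b' = b(k := (1 / s) *\<^sub>R w)"
    have "b' i \<bullet> (A *v b' j) = (if i = j then 1 else 0)" if "i \<in> insert k S" "j \<in> insert k S" for i j
      using that insert.hyps s(1)
      by (auto simp: b'_def b orth orth' matrix_vector_mult_scaleR s(2))
    then show ?case
      by blast
  qed
  from this[of UNIV] obtain b :: "'n \<Rightarrow> real^'n" where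
    b: "\<And>i j. b i \<bullet> (A *v b j) = (if i = j then 1 else 0)"
    by auto
  define C where "C = (\<chi> i j. b j $ i)"
  have "(transpose C ** A ** C) $ i $ j = b i \<bullet> (A *v b j)" for i j
    unfolding matrix_mul_assoc[symmetric]
    by (simp add: C_def inner_vec_def matrix_matrix_mult_def matrix_vector_mult_def transpose_def)
  then have "transpose C ** A ** C = mat 1"
    by (simp add: vec_eq_iff mat_def b)
  then show ?thesis
    by (rule that)
qed

text \<open>
  The substitution \<open>x = C u\<close> that carries the standard Gaussian to covariance \<open>P\<close>. Its
  Jacobian factor \<open>\<bar>det C\<bar>\<close> is \<open>sqrt (det P)\<close>, which is the normalizing factor of the density.
\<close>
lemma gaussian_whitening:
  fixes P :: "real^'n^'n"
  assumes P: "sym_pos_def P"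
  obtains C :: "real^'n^'n" where "det C \<noteq> 0" "(det C)\<^sup>2 = det P"
    "\<And>u. (C *v u) \<bullet> (matrix_inv P *v (C *v u)) = u \<bullet> u"
proof -
  obtain C :: "real^'n^'n" where C: "transpose C ** matrix_inv P ** C = mat 1"
    by (rule sym_pos_def_congruent_identity[OF sym_pos_def_inverse(3)[OF P]])
  have "det P * det (matrix_inv P) = 1"
    using arg_cong[OF sym_pos_def_inverse(1)[OF P], of det] by (simp add: det_mul)
  moreover have "det C * det (matrix_inv P) * det C = 1"
    using arg_cong[OF C, of det] by (simp add: det_mul det_transpose)
  ultimately have "det C \<noteq> 0" and det: "(det C)\<^sup>2 = det P"
    by (auto simp: power2_eq_square) algebra
  moreover have "(C *v u) \<bullet> (matrix_inv P *v (C *v u)) = u \<bullet> u" for u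
    by (simp only: inner_congruence C matrix_vector_mul_lid)
  ultimately show ?thesis
    by (rule that)
qed

lemma sym_pos_def_det_pos:
  assumes "sym_pos_def P" shows "0 < det P"
  by (rule gaussian_whitening[OF assms]) (metis zero_less_power2)

section \<open>Gaussian densities: normalization and quadratic moments\<close>
lemma gaussian_density_pos: "sym_pos_def P \<Longrightarrow> 0 < gaussian_density m P x"
  by (simp add: gaussian_density_def sym_pos_def_det_pos)

lemma borel_measurable_gaussian_density [measurable]:
  "gaussian_density m P \<in> borel_measurable borel"
  unfolding gaussian_density_def by measurable

lemma nn_integral_gaussian_density:
  fixes P :: "real^'n^'n"
  assumes P: "sym_pos_def P"
  shows "(\<integral>\<^sup>+x. gaussian_density m P x \<partial>lborel) = 1"
proof -
  obtain C where C: "det C \<noteq> 0" "(det C)\<^sup>2 = det P"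
    "\<And>u. (C *v u) \<bullet> (matrix_inv P *v (C *v u)) = u \<bullet> u"
    using gaussian_whitening[OF P] by metis
  have std: "\<bar>det C\<bar> * gaussian_density m P (m + C *v u) = (\<Prod>b\<in>Basis. std_normal_density (u \<bullet> b))" for u
  proof -
    have "sqrt (det P) = \<bar>det C\<bar>"
      by (simp flip: C(2))
    then have "\<bar>det C\<bar> * gaussian_density m P (m + C *v u) = exp (- (u \<bullet> u) / 2) / sqrt (2 * pi) ^ CARD('n)"
      using C(1) by (simp add: gaussian_density_def C(3) real_sqrt_mult real_sqrt_power power_mult_distrib)
    also have "u \<bullet> u = (\<Sum>b\<in>Basis. (u \<bullet> b)\<^sup>2)"
      by (subst euclidean_inner) (simp add: power2_eq_square)
    also have "exp (- (\<Sum>b\<in>Basis. (u \<bullet> b)\<^sup>2) / 2) = (\<Prod>b\<in>Basis. exp (- (u \<bullet> b)\<^sup>2 / 2))"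
      by (simp add: exp_sum sum_negf sum_divide_distrib flip: sum_negf)
    finally show ?thesis
      by (simp add: std_normal_density_def prod_dividef)
  qed
  have "(\<integral>\<^sup>+x. gaussian_density m P x \<partial>lborel) = (\<integral>\<^sup>+x. gaussian_density m P (m + x) \<partial>lborel)"
    by (subst lborel_distr_plus[of m, symmetric]) (simp add: nn_integral_distr)
  also have "\<dots> = ennreal \<bar>det C\<bar> * (\<integral>\<^sup>+u. gaussian_density m P (m + C *v u) \<partial>lborel)"
    by (rule nn_integral_lborel_linear_substitution) (use C(1) in auto)
  also have "\<dots> = (\<integral>\<^sup>+u. (\<Prod>b\<in>(Basis :: (real^'n) set). std_normal_density (u \<bullet> b)) \<partial>lborel)"
    by (subst nn_integral_cmult[symmetric]) (simp_all add: std flip: ennreal_mult')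
  also have "\<dots> = (\<integral>\<^sup>+u. (\<Prod>b\<in>(Basis :: (real^'n) set). ennreal (std_normal_density (u \<bullet> b))) \<partial>lborel)"
    by (simp add: prod_ennreal)
  also have "\<dots> = (\<Prod>b\<in>(Basis :: (real^'n) set). \<integral>\<^sup>+t. std_normal_density t \<partial>lborel)"
    by (rule nn_integral_lborel_prod) auto
  also have "(\<integral>\<^sup>+t. std_normal_density t \<partial>lborel) = 1"
    by (simp add: nn_integral_eq_integral)
  finally show ?thesis
    by simp
qed

lemma integrable_gaussian_density:
  "sym_pos_def P \<Longrightarrow> integrable lborel (gaussian_density m P)"
  by (rule integrableI_nonneg)
    (auto simp: nn_integral_gaussian_density gaussian_density_pos less_imp_le)

lemma integral_gaussian_density:
  "sym_pos_def P \<Longrightarrow> (\<integral>x. gaussian_density m P x \<partial>lborel) = 1"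
  by (subst integral_eq_nn_integral)
    (auto simp: nn_integral_gaussian_density gaussian_density_pos less_imp_le)

text \<open>
  Lets a multiple of the exponent of the Gaussian density control the Euclidean norm.
\<close>
lemma sym_pos_def_inverse_coercive:
  fixes P :: "real^'n^'n"
  assumes P: "sym_pos_def P"
  obtains k where "0 \<le> k" "\<And>z. (norm z)\<^sup>2 \<le> k * (z \<bullet> (matrix_inv P *v z))"
proof -
  obtain C where C: "det C \<noteq> 0"
    "\<And>u. (C *v u) \<bullet> (matrix_inv P *v (C *v u)) = u \<bullet> u"
    using gaussian_whitening[OF P] by metis
  obtain D where D: "C ** D = mat 1"
    using C(1) unfolding invertible_det_nz[symmetric] invertible_def by blast
  have "(norm z)\<^sup>2 \<le> (onorm ((*v) C))\<^sup>2 * (z \<bullet> (matrix_inv P *v z))" for z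
  proof -
    have z: "C *v (D *v z) = z"
      by (simp add: matrix_vector_mul_assoc D)
    have "norm (C *v (D *v z)) \<le> onorm ((*v) C) * norm (D *v z)"
      by (rule onorm) simp
    then have "(norm z)\<^sup>2 \<le> (onorm ((*v) C))\<^sup>2 * (norm (D *v z))\<^sup>2"
      unfolding z by (metis norm_ge_zero power_mono power_mult_distrib)
    also have "(norm (D *v z))\<^sup>2 = z \<bullet> (matrix_inv P *v z)"
      using C(2)[of "D *v z"] by (simp add: z power2_norm_eq_inner)
    finally show ?thesis .
  qed
  then show ?thesis
    by (intro that[of "(onorm ((*v) C))\<^sup>2"]) auto
qed

text \<open>
  Let \<open>t\<close> be the quadratic form in the exponent. Since \<open>t / 4 \<le> exp (t / 4)\<close>, the product
  \<open>t * exp (- t / 2)\<close> is at most \<open>4 * exp (- t / 4)\<close>, and this is a multiple of the density with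
  covariance \<open>2 P\<close>. As \<open>t\<close> dominates the squared distance from the mean up to a factor,
  integrability of that density suffices.
\<close>
lemma integrable_gaussian_density_norm_sq:
  fixes P :: "real^'n^'n"
  assumes P: "sym_pos_def P"
  shows "integrable lborel (\<lambda>x. gaussian_density m P x * (norm x)\<^sup>2)"
proof -
  let ?t = "\<lambda>x. (x - m) \<bullet> (matrix_inv P *v (x - m))"
  let ?Z = "\<lambda>P::real^'n^'n. sqrt ((2 * pi) ^ CARD('n) * det P)"
  have P2: "sym_pos_def (2 *\<^sub>R P)"
    using P by (simp add: sym_pos_def_def transpose_scalar scaleR_matrix_vector_assoc[symmetric])
  have Z: "0 < ?Z P" "0 < ?Z (2 *\<^sub>R P)"
    using sym_pos_def_det_pos[OF P] sym_pos_def_det_pos[OF P2] by simp_all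
  have inv2: "matrix_inv (2 *\<^sub>R P) = (1/2) *\<^sub>R matrix_inv P"
    by (rule matrix_inv_eqI)
      (simp add: matrix_scalar_ac scalar_matrix_assoc[symmetric] sym_pos_def_inverse(1)[OF P])
  \<comment> \<open>4 from the estimate of the exponential, times the ratio of the two normalizing constants\<close>
  define c where "c = 4 * ?Z (2 *\<^sub>R P) / ?Z P"
  have moment: "gaussian_density m P x * ?t x \<le> c * gaussian_density m (2 *\<^sub>R P) x" for x
  proof -
    have "?t x / 4 \<le> exp (?t x / 4)"
      using exp_ge_add_one_self[of "?t x / 4"] by linarith
    then have "exp (- (1/2) * ?t x) * ?t x \<le> exp (- (1/2) * ?t x) * (4 * exp (?t x / 4))"
      by (intro mult_left_mono) auto
    also have "\<dots> = 4 * exp (- (1/4) * ?t x)"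
      by (simp flip: exp_add)
    finally have "exp (- (1/2) * ?t x) * ?t x / ?Z P \<le> 4 * exp (- (1/4) * ?t x) / ?Z P"
      using Z(1) by (intro divide_right_mono) auto
    also have "\<dots> = c * gaussian_density m (2 *\<^sub>R P) x"
      using Z(2) sym_pos_def_det_pos[OF P2]
      by (simp add: c_def gaussian_density_def inv2 scaleR_matrix_vector_assoc[symmetric])
    finally show ?thesis
      by (simp add: gaussian_density_def)
  qed
  obtain k where k: "0 \<le> k" "\<And>z. (norm z)\<^sup>2 \<le> k * (z \<bullet> (matrix_inv P *v z))"
    using sym_pos_def_inverse_coercive[OF P] by blast
  have bound: "gaussian_density m P x * (norm x)\<^sup>2 \<le>
      2 * (norm m)\<^sup>2 * gaussian_density m P x + 2 * k * (c * gaussian_density m (2 *\<^sub>R P) x)" for x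
  proof -
    have q: "0 \<le> gaussian_density m P x"
      using gaussian_density_pos[OF P] by (simp add: less_imp_le)
    have "(norm x)\<^sup>2 \<le> (norm m + norm (x - m))\<^sup>2"
      using norm_triangle_sub[of x m] by (intro power_mono) auto
    also have "\<dots> \<le> 2 * (norm m)\<^sup>2 + 2 * (norm (x - m))\<^sup>2"
      using sum_squares_bound[of "norm m" "norm (x - m)"] by (simp add: power2_sum)
    also have "\<dots> \<le> 2 * (norm m)\<^sup>2 + 2 * (k * ?t x)"
      using k(2)[of "x - m"] by simp
    finally have "gaussian_density m P x * (norm x)\<^sup>2 \<le>
        gaussian_density m P x * (2 * (norm m)\<^sup>2 + 2 * (k * ?t x))"
      using q by (rule mult_left_mono)
    also have "\<dots> = 2 * (norm m)\<^sup>2 * gaussian_density m P x + 2 * k * (gaussian_density m P x * ?t x)"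
      by (simp add: algebra_simps)
    also have "\<dots> \<le> 2 * (norm m)\<^sup>2 * gaussian_density m P x + 2 * k * (c * gaussian_density m (2 *\<^sub>R P) x)"
      using moment[of x] k(1) by (intro add_left_mono mult_left_mono) auto
    finally show ?thesis .
  qed
  show ?thesis
  proof (rule Bochner_Integration.integrable_bound)
    show "integrable lborel (\<lambda>x. 2 * (norm m)\<^sup>2 * gaussian_density m P x +
        2 * k * (c * gaussian_density m (2 *\<^sub>R P) x))"
      using integrable_gaussian_density[OF P] integrable_gaussian_density[OF P2] by simp
  next
    show "AE x in lborel. norm (gaussian_density m P x * (norm x)\<^sup>2) \<le>
        norm (2 * (norm m)\<^sup>2 * gaussian_density m P x + 2 * k * (c * gaussian_density m (2 *\<^sub>R P) x))"
    proof (rule AE_I2)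
      fix x
      have "0 \<le> gaussian_density m P x * (norm x)\<^sup>2"
        using gaussian_density_pos[OF P, of m x] by simp
      then show "norm (gaussian_density m P x * (norm x)\<^sup>2) \<le>
        norm (2 * (norm m)\<^sup>2 * gaussian_density m P x + 2 * k * (c * gaussian_density m (2 *\<^sub>R P) x))"
        using bound[of x] by simp
    qed
  qed measurable
qed

lemma integrable_gaussian_quadratic:
  fixes P :: "real^'n^'n" and M :: "real^'n^'k" and B :: "real^'k^'k"
  assumes P: "sym_pos_def P"
  shows "integrable (density lborel (gaussian_density m P)) (\<lambda>x. (c + M *v x) \<bullet> (B *v (c + M *v x)))"
proof -
  let ?q = "gaussian_density m P" and ?f = "\<lambda>x. c + M *v x"
  let ?M = "onorm ((*v) M)" and ?B = "onorm ((*v) B)"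
  have B0: "0 \<le> ?B"
    by (rule onorm_pos_le) simp
  have bound: "\<bar>?f x \<bullet> (B *v ?f x)\<bar> \<le> 2 * ?B * (norm c)\<^sup>2 + 2 * ?B * ?M\<^sup>2 * (norm x)\<^sup>2" for x
  proof -
    have "norm (M *v x) \<le> ?M * norm x"
      by (rule onorm) simp
    then have "norm (?f x) \<le> norm c + ?M * norm x"
      using norm_triangle_ineq[of c "M *v x"] by linarith
    then have "(norm (?f x))\<^sup>2 \<le> (norm c + ?M * norm x)\<^sup>2"
      by (intro power_mono) auto
    also have "\<dots> \<le> 2 * (norm c)\<^sup>2 + 2 * (?M * norm x)\<^sup>2"
      using sum_squares_bound[of "norm c" "?M * norm x"] by (simp add: power2_sum)
    finally have f: "(norm (?f x))\<^sup>2 \<le> 2 * (norm c)\<^sup>2 + 2 * (?M * norm x)\<^sup>2" .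
    have "\<bar>?f x \<bullet> (B *v ?f x)\<bar> \<le> norm (?f x) * norm (B *v ?f x)"
      by (rule Cauchy_Schwarz_ineq2)
    also have "\<dots> \<le> norm (?f x) * (?B * norm (?f x))"
      by (intro mult_left_mono onorm) auto
    also have "\<dots> = ?B * (norm (?f x))\<^sup>2"
      by (simp add: power2_eq_square)
    also have "\<dots> \<le> ?B * (2 * (norm c)\<^sup>2 + 2 * (?M * norm x)\<^sup>2)"
      using f B0 by (rule mult_left_mono)
    finally show ?thesis
      by (simp add: algebra_simps power_mult_distrib)
  qed
  have q: "0 \<le> ?q x" for x
    using gaussian_density_pos[OF P] by (simp add: less_imp_le)
  have "integrable lborel (\<lambda>x. ?q x * (?f x \<bullet> (B *v ?f x)))"
  proof (rule Bochner_Integration.integrable_bound)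
    show "integrable lborel (\<lambda>x. 2 * ?B * (norm c)\<^sup>2 * ?q x + 2 * ?B * ?M\<^sup>2 * (?q x * (norm x)\<^sup>2))"
      using integrable_gaussian_density[OF P] integrable_gaussian_density_norm_sq[OF P] by simp
  next
    show "AE x in lborel. norm (?q x * (?f x \<bullet> (B *v ?f x))) \<le>
        norm (2 * ?B * (norm c)\<^sup>2 * ?q x + 2 * ?B * ?M\<^sup>2 * (?q x * (norm x)\<^sup>2))"
    proof (rule AE_I2)
      fix x
      have "norm (?q x * (?f x \<bullet> (B *v ?f x))) = ?q x * \<bar>?f x \<bullet> (B *v ?f x)\<bar>"
        using q[of x] by (simp add: abs_mult)
      also have "\<dots> \<le> ?q x * (2 * ?B * (norm c)\<^sup>2 + 2 * ?B * ?M\<^sup>2 * (norm x)\<^sup>2)"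
        using bound q by (rule mult_left_mono)
      also have "\<dots> = 2 * ?B * (norm c)\<^sup>2 * ?q x + 2 * ?B * ?M\<^sup>2 * (?q x * (norm x)\<^sup>2)"
        by (simp add: algebra_simps)
      finally show "norm (?q x * (?f x \<bullet> (B *v ?f x))) \<le>
        norm (2 * ?B * (norm c)\<^sup>2 * ?q x + 2 * ?B * ?M\<^sup>2 * (?q x * (norm x)\<^sup>2))"
        by simp
    qed
  qed measurable
  then show ?thesis
    by (subst integrable_real_density) (auto simp: q)
qed

section \<open>Gibbs' inequality\<close>
lemma ln_gaussian_density:
  fixes P :: "real^'n^'n"
  assumes P: "sym_pos_def P"
  shows "ln (gaussian_density m P x) =
    - (1/2) * ((x - m) \<bullet> (matrix_inv P *v (x - m))) - ln (sqrt ((2 * pi) ^ CARD('n) * det P))"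
  using sym_pos_def_det_pos[OF P] by (simp add: gaussian_density_def ln_div)

lemma prob_space_gaussian:
  assumes P: "sym_pos_def P"
  shows "prob_space (density lborel (gaussian_density m P))"
  by (rule prob_spaceI) (simp add: emeasure_density nn_integral_gaussian_density[OF P])

lemma integrable_gaussian_ln_gaussian_density:
  assumes P: "sym_pos_def P" and P': "sym_pos_def P'"
  shows "integrable (density lborel (gaussian_density m P)) (\<lambda>x. ln (gaussian_density m' P' x))"
proof -
  interpret prob_space "density lborel (gaussian_density m P)"
    by (rule prob_space_gaussian[OF P])
  have "integrable (density lborel (gaussian_density m P)) (\<lambda>x. (x - m') \<bullet> (matrix_inv P' *v (x - m')))"
    using integrable_gaussian_quadratic[OF P, of m "- m'" "mat 1" "matrix_inv P'"] by simp
  then show ?thesis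
    unfolding ln_gaussian_density[OF P'] by simp
qed

text \<open>
  By \<open>ln s \<le> s - 1\<close> with \<open>s = r / q\<close>, the left-hand side exceeds the right-hand side by at most
  the integral of \<open>r - q\<close>, which vanishes because both densities have total mass one.
\<close>
lemma gibbs_inequality_gaussian:
  assumes P: "sym_pos_def P" and P': "sym_pos_def P'"
  shows "expect (gaussian_density m P) (\<lambda>x. ln (gaussian_density m' P' x)) \<le>
    expect (gaussian_density m P) (\<lambda>x. ln (gaussian_density m P x))"
proof -
  let ?q = "gaussian_density m P" and ?r = "gaussian_density m' P'"
  let ?Q = "density lborel ?q"
  note int = integrable_gaussian_ln_gaussian_density[OF P]
  have q: "0 < ?q x" and r: "0 < ?r x" for x
    using gaussian_density_pos P P' by auto
  have "expect ?q (\<lambda>x. ln (?r x)) - expect ?q (\<lambda>x. ln (?q x)) = (\<integral>x. ln (?r x) - ln (?q x) \<partial>?Q)"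
    unfolding expect_def by (rule Bochner_Integration.integral_diff[symmetric]) (intro int P P')+
  also have "\<dots> = (\<integral>x. ?q x * (ln (?r x) - ln (?q x)) \<partial>lborel)"
    by (rule integral_real_density) (auto simp: q less_imp_le)
  also have "\<dots> \<le> (\<integral>x. ?r x - ?q x \<partial>lborel)"
  proof (rule integral_mono)
    show "integrable lborel (\<lambda>x. ?q x * (ln (?r x) - ln (?q x)))"
      using Bochner_Integration.integrable_diff[OF int[OF P'] int[OF P], of m m' m]
      by (subst (asm) integrable_real_density) (auto simp: q less_imp_le)
    show "integrable lborel (\<lambda>x. ?r x - ?q x)"
      by (intro Bochner_Integration.integrable_diff integrable_gaussian_density P P')
  next
    fix x
    have "ln (?r x) - ln (?q x) = ln (?r x / ?q x)"
      using q[of x] r[of x] by (simp add: ln_div)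
    also have "\<dots> \<le> ?r x / ?q x - 1"
      using q[of x] r[of x] by (intro ln_le_minus_one) simp
    finally show "?q x * (ln (?r x) - ln (?q x)) \<le> ?r x - ?q x"
      using q[of x] by (simp add: field_simps)
  qed
  also have "\<dots> = 0"
    by (simp add: integrable_gaussian_density integral_gaussian_density P P')
  finally show ?thesis
    by simp
qed

section \<open>The Kalman update in information form\<close>
lemma matrix_sub_ldistrib: "(A :: real^'n^'m) ** (B - C) = A ** B - A ** C"
  by (simp add: matrix_eq algebra_simps flip: matrix_vector_mul_assoc)

lemma matrix_add_rdistrib: "(A + B :: real^'n^'m) ** C = A ** C + B ** C"
  by (simp add: matrix_eq algebra_simps flip: matrix_vector_mul_assoc)

text \<open>
  A case of the Woodbury identity. The push-through identity \<open>A \<Sigma> H\<^sup>T = H\<^sup>T R\<^sup>-\<^sup>1 S\<close>, multiplied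
  by \<open>S\<^sup>-\<^sup>1\<close> on the right, gives the first claim. With \<open>S K\<^sup>T = H \<Sigma>\<close> that claim turns the product
  of \<open>A\<close> and the updated covariance into \<open>A \<Sigma> - H\<^sup>T R\<^sup>-\<^sup>1 H \<Sigma>\<close>, which is the identity.
\<close>
lemma kalman_information_form:
  fixes H :: "real^'d^'p" and \<Sigma> :: "real^'d^'d" and R :: "real^'p^'p"
  assumes \<Sigma>: "sym_pos_def \<Sigma>" and R: "sym_pos_def R"
  defines "S \<equiv> H ** \<Sigma> ** transpose H + R"
  defines "K \<equiv> \<Sigma> ** transpose H ** matrix_inv S"
  defines "A \<equiv> matrix_inv \<Sigma> + transpose H ** matrix_inv R ** H"
  shows "A ** K = transpose H ** matrix_inv R"
    and "A ** (\<Sigma> - K ** S ** transpose K) = mat 1"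
    and "sym_pos_def A"
proof -
  have S: "sym_pos_def S"
    using sym_pos_def_add_congruence[OF R \<Sigma>, of H] by (simp add: S_def add.commute)
  note Sinv = sym_pos_def_inverse[OF S] and Rinv = sym_pos_def_inverse[OF R]
    and \<Sigma>inv = sym_pos_def_inverse[OF \<Sigma>]
  have A\<Sigma>: "A ** \<Sigma> = mat 1 + transpose H ** matrix_inv R ** H ** \<Sigma>"
    by (simp add: A_def matrix_add_rdistrib \<Sigma>inv)
  have "A ** \<Sigma> ** transpose H = transpose H ** matrix_inv R ** (R + H ** \<Sigma> ** transpose H)"
  proof -
    have "transpose H ** matrix_inv R ** R = transpose H"
      by (simp add: Rinv flip: matrix_mul_assoc)
    then show ?thesis
      unfolding A\<Sigma> by (simp add: matrix_add_rdistrib matrix_add_ldistrib matrix_mul_assoc)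
  qed
  then have A\<Sigma>H: "A ** \<Sigma> ** transpose H = transpose H ** matrix_inv R ** S"
    by (simp add: S_def add.commute)
  have "A ** K = transpose H ** matrix_inv R ** (S ** matrix_inv S)"
    by (simp only: K_def matrix_mul_assoc A\<Sigma>H)
  then show AK: "A ** K = transpose H ** matrix_inv R"
    by (simp add: Sinv)
  have "transpose K = matrix_inv S ** H ** \<Sigma>"
    using Sinv(3) \<Sigma> by (simp add: K_def matrix_transpose_mul sym_pos_def_def matrix_mul_assoc)
  then have "S ** transpose K = H ** \<Sigma>"
    by (simp add: matrix_mul_assoc Sinv)
  then have "A ** (\<Sigma> - K ** S ** transpose K) = A ** \<Sigma> - A ** K ** (H ** \<Sigma>)"
    by (simp add: matrix_sub_ldistrib flip: matrix_mul_assoc)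
  then show "A ** (\<Sigma> - K ** S ** transpose K) = mat 1"
    by (simp add: AK A\<Sigma> matrix_mul_assoc)
  show "sym_pos_def A"
    using sym_pos_def_add_congruence[OF \<Sigma>inv(3) Rinv(3), of "transpose H"] by (simp add: A_def)
qed

lemma quadratic_form_diff:
  assumes "sym_pos_def B"
  shows "(x - y) \<bullet> (B *v (x - y)) = x \<bullet> (B *v x) - 2 * (x \<bullet> (B *v y)) + y \<bullet> (B *v y)"
  using sym_pos_def_inner_commute[OF assms, of x y]
  by (simp add: matrix_vector_mult_diff_distrib inner_diff_left inner_diff_right)

text \<open>
  Up to the factor \<open>- 1/2\<close> and constants, the left-hand side is the log-likelihood of a linear
  observation plus the log-prior with precision \<open>J\<close>, as functions of the deviation \<open>z\<close> from the
  prior mean. The centre \<open>k\<close> is the solution of the normal equations.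
\<close>
lemma complete_square:
  fixes H :: "real^'d^'p" and J :: "real^'d^'d" and Q :: "real^'p^'p"
  assumes Q: "sym_pos_def Q" and A: "sym_pos_def (J + transpose H ** Q ** H)"
    and k: "(J + transpose H ** Q ** H) *v k = transpose H *v (Q *v e)"
  shows "(e - H *v z) \<bullet> (Q *v (e - H *v z)) + z \<bullet> (J *v z) =
    (z - k) \<bullet> ((J + transpose H ** Q ** H) *v (z - k))
      + (e \<bullet> (Q *v e) - k \<bullet> ((J + transpose H ** Q ** H) *v k))"
proof -
  have "z \<bullet> ((J + transpose H ** Q ** H) *v z) = z \<bullet> (J *v z) + (H *v z) \<bullet> (Q *v (H *v z))"
    by (simp only: matrix_vector_mult_add_rdistrib inner_add_right inner_congruence)
  moreover have "z \<bullet> ((J + transpose H ** Q ** H) *v k) = e \<bullet> (Q *v (H *v z))"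
  proof -
    have "z \<bullet> (transpose H *v (Q *v e)) = (H *v z) \<bullet> (Q *v e)"
      by (simp only: inner_matrix_transpose[of z "transpose H"] transpose_transpose)
    then show ?thesis
      unfolding k by (simp only: sym_pos_def_inner_commute[OF Q, of e])
  qed
  ultimately show ?thesis
    unfolding quadratic_form_diff[OF Q] quadratic_form_diff[OF A] by linarith
qed

section \<open>Optimality of the extended Kalman filter update\<close>
theorem corollary2:
  fixes h :: "real ^ 'd \<Rightarrow> real ^ 'p"
    and \<mu> :: "real ^ 'd" and \<Sigma> :: "real ^ 'd ^ 'd"
    and R :: "real ^ 'p ^ 'p" and y :: "real ^ 'p"
  assumes "h differentiable (at \<mu>)"
    and "sym_pos_def \<Sigma>"
    and "sym_pos_def R"
  shows "is_arg_max
           (\<lambda>(m, P). variational_objective (taylor1 h \<mu>) R y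
                        (gaussian_density \<mu> \<Sigma>) (gaussian_density m P))
           (\<lambda>(m, P). sym_pos_def P)
           (ekf_mean h \<mu> \<Sigma> R y, ekf_cov h \<mu> \<Sigma> R)"
proof -
  note \<Sigma> = \<open>sym_pos_def \<Sigma>\<close> and R = \<open>sym_pos_def R\<close>
  define H where "H = jacobian h (at \<mu>)"
  define A where "A = matrix_inv \<Sigma> + transpose H ** matrix_inv R ** H"
  let ?m = "ekf_mean h \<mu> \<Sigma> R y" and ?P = "ekf_cov h \<mu> \<Sigma> R"
  let ?r = "gaussian_density ?m ?P" and ?p = "gaussian_density \<mu> \<Sigma>"
  let ?res = "\<lambda>x. (y - taylor1 h \<mu> x) \<bullet> (matrix_inv R *v (y - taylor1 h \<mu> x))"
  let ?L = "\<lambda>m P. variational_objective (taylor1 h \<mu>) R y ?p (gaussian_density m P)"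
  have AK: "A ** ekf_K h \<mu> \<Sigma> R = transpose H ** matrix_inv R"
    and AP: "A ** ?P = mat 1" and A: "sym_pos_def A"
    using kalman_information_form[OF \<Sigma> R, of H]
    by (simp_all add: A_def H_def ekf_K_def ekf_S_def ekf_cov_def)
  have P: "sym_pos_def ?P"
    using sym_pos_def_inverse(3)[OF A] matrix_inv_eqI[OF AP] by simp
  have invP: "matrix_inv ?P = A"
    by (rule matrix_inv_eqI) (use AP matrix_left_right_inverse in auto)
  \<comment> \<open>the observation term and the log-prior add up to the log-density of the update plus a constant\<close>
  have "\<exists>c. \<forall>x. - (1/2) * ?res x + ln (?p x) = c + ln (?r x)"
  proof -
    define e where "e = y - h \<mu>"
    define k where "k = ekf_K h \<mu> \<Sigma> R *v e"
    have "A *v k = transpose H *v (matrix_inv R *v e)"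
      by (simp only: k_def matrix_vector_mul_assoc AK)
    note square = complete_square[OF sym_pos_def_inverse(3)[OF R] A[unfolded A_def] this[unfolded A_def],
        folded A_def]
    have centred: "y - taylor1 h \<mu> x = e - H *v (x - \<mu>)" "x - ?m = (x - \<mu>) - k" for x
      by (simp_all add: taylor1_def e_def H_def k_def ekf_mean_def)
    have "- (1/2) * ?res x + ln (?p x) =
        (- (1/2) * (e \<bullet> (matrix_inv R *v e) - k \<bullet> (A *v k))
          - ln (sqrt ((2 * pi) ^ CARD('d) * det \<Sigma>)) + ln (sqrt ((2 * pi) ^ CARD('d) * det ?P)))
        + ln (?r x)" for x
      using square[of "x - \<mu>"] unfolding ln_gaussian_density[OF \<Sigma>] ln_gaussian_density[OF P] invP centred
      by argo
    then show ?thesis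
      by blast
  qed
  then obtain c where c: "\<And>x. - (1/2) * ?res x + ln (?p x) = c + ln (?r x)"
    by blast
  \<comment> \<open>the objective is a constant minus the relative entropy of the candidate with respect to the update\<close>
  have L: "?L m P' = c + expect (gaussian_density m P') (\<lambda>x. ln (?r x))
      - expect (gaussian_density m P') (\<lambda>x. ln (gaussian_density m P' x))"
    if P': "sym_pos_def P'" for m P'
  proof -
    let ?Q = "density lborel (\<lambda>x. ennreal (gaussian_density m P' x))"
    interpret prob_space ?Q
      by (rule prob_space_gaussian[OF P'])
    have int_ln: "integrable ?Q (\<lambda>x. ln (gaussian_density m' P'' x))" if "sym_pos_def P''" for m' P''
      by (rule integrable_gaussian_ln_gaussian_density[OF P' that])
    have res: "y - taylor1 h \<mu> x = (y - h \<mu> + H *v \<mu>) + (- H) *v x" for x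
    proof -
      have "(- H) *v x = - (H *v x)"
        by (simp add: matrix_vector_mult_def vec_eq_iff sum_negf)
      then show ?thesis
        by (simp add: taylor1_def H_def matrix_vector_mult_diff_distrib)
    qed
    have int_res: "integrable ?Q ?res"
      unfolding res by (rule integrable_gaussian_quadratic[OF P'])
    have "- (1/2) * integral\<^sup>L ?Q ?res + (\<integral>x. ln (?p x) \<partial>?Q) = (\<integral>x. - (1/2) * ?res x + ln (?p x) \<partial>?Q)"
      using int_res int_ln[OF \<Sigma>] by simp
    also have "\<dots> = c + (\<integral>x. ln (?r x) \<partial>?Q)"
      unfolding c using int_ln[OF P] prob_space by simp
    finally show ?thesis
      by (simp only: variational_objective_def expect_def)
  qed
  have "?L m P' \<le> ?L ?m ?P" if "sym_pos_def P'" for m P'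
    using L[OF that, of m] L[OF P, of ?m] gibbs_inequality_gaussian[OF that P, of m ?m] by linarith
  then show ?thesis
    using P by (auto simp: is_arg_max_def not_less)
qed

end
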